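(* Let $Q$ be a finite acyclic quiver, $\mathbf d\in\mathbb N^{Q_0}$ a dimension vector and $\theta\in\mathbb Z^{Q_0}$ a generic stability parameter for $\mathbf d$. Let $\ell\ge1$ and let $\mathbf d^\ell=(d_{i,n})_{i\in Q_0,\,1\le n\le\ell}$ be a dimension vector of $Q^\ell$ with $\sum_{n=1}^\ell d_{i,n}=d_i$ for all $i\in Q_0$. Let $\theta^\ell=(\theta_{i,n})$ with $\theta_{i,n}=\theta_i$ for all $i\in Q_0$ and $n=1,\dots,\ell$. Let $\mathcal C=(V_{\bullet\bullet},X_{\bullet\bullet},Y_{\bullet\bullet})$ be a quiver chain of dimension vector $\mathbf d^\ell$ and let $\mathbf V=\tilde\iota_{\mathbf d^\ell}(\mathcal C)$ be the Nakajima quiver representation obtained by collapsing. Then $\mathcal C$ is $\theta^\ell$-semistable (respectively $\theta^\ell$-stable) if and only if $\mathbf V$ is $\theta$-semistable (respectively $\theta$-stable).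
   Context: Let $Q=(Q_0,Q_1,h,t)$ be a finite quiver with head and tail maps $h,t$. The doubled quiver $\overline Q$ has the same vertices and, in addition to each $\alpha\in Q_1$, an opposite arrow $\overline\alpha$ from $h\alpha$ to $t\alpha$. A representation of $\overline Q$ is $(V,X,Y)$ with vector spaces $V_i$ and linear maps $X_\alpha:V_{t\alpha}\to V_{h\alpha}$, $Y_{\overline\alpha}:V_{h\alpha}\to V_{t\alpha}$. It is a Nakajima quiver representation if $\sum_{h\alpha=i}X_\alpha Y_{\overline\alpha}-\sum_{t\alpha=i}Y_{\overline\alpha}X_\alpha=0$ for all $i\in Q_0$ (sums over $\alpha\in Q_1$). Generic means $\theta\cdot\mathbf d=0$ and $\theta\cdot\mathbf e\neq0$ for every $\mathbf e\in\mathbb N^{Q_0}$ with $\mathbf e\le\mathbf d$, $\mathbf e\ne0,\mathbf d$. Quiver $Q^\ell$: vertices $(i,n)$, $i\in Q_0$, $n=1,\dots,\ell$; arrows $(\alpha,n):(t\alpha,n)\to(h\alpha,n)$ for $\alpha\in Q_1$, $n=1,\dots,\ell$, and $(\overline\alpha,n):(h\alpha,n)\to(t\alpha,n+1)$ for $\alpha\in Q_1$, $n=1,\dots,\ell-1$. A quiver chain ($Q$-chain) is a representation $(V_{\bullet\bullet},X_{\bullet\bullet},Y_{\bullet\bullet})$ of $Q^\ell$, with spaces $V_{i,n}$ and maps $X_{\alpha,n}:V_{t\alpha,n}\to V_{h\alpha,n}$, $Y_{\overline\alpha,n}:V_{h\alpha,n}\to V_{t\alpha,n+1}$, satisfying the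 relations $\mathcal R^\ell$: $\sum_{h\alpha=i}X_{\alpha,n+1}Y_{\overline\alpha,n}-\sum_{t\alpha=i}Y_{\overline\alpha,n}X_{\alpha,n}=0$ for all $i\in Q_0$, $n=1,\dots,\ell-1$. Collapsing map: $\tilde\iota_{\mathbf d^\ell}(V_{\bullet\bullet},X_{\bullet\bullet},Y_{\bullet\bullet})=(V,X,Y)$ with $V_i=\bigoplus_{n=1}^\ell V_{i,n}$, $X_\alpha=\bigoplus_{n=1}^\ell X_{\alpha,n}$, $Y_{\overline\alpha}=\bigoplus_{n=1}^{\ell-1}Y_{\overline\alpha,n}$ (zero on $V_{h\alpha,\ell}$). Stability: for a stability vector $\eta$ on the vertices of a quiver, a representation $\mathbf V$ is $\eta$-semistable (stable) if $\mu_\eta(\mathbf W)\le\mu_\eta(\mathbf V)$ ($<$) for every proper nonzero subrepresentation $\mathbf W$, where $\mu_\eta(\mathbf W)=\eta\cdot\mathbf d_{\mathbf W}/|\mathbf d_{\mathbf W}|$, with $\mathbf d_{\mathbf W}$ the dimension vector and $|\mathbf d_{\mathbf W}|$ the total dimension of $\mathbf W$. *)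

theory Defs
  imports
    "Graph_Theory.Digraph"
    "Graph_Theory.Arc_Walk"
    "HOL-Library.Function_Algebras"
begin

text \<open>
  Quivers are directed multigraphs; loops and parallel arrows are allowed, so finite quivers are exactly the
  instances of \<^locale>\<open>fin_digraph\<close>.
\<close>

definition acyclic_quiver :: "('i, 'a) pre_digraph \<Rightarrow> bool" where
  "acyclic_quiver Q \<longleftrightarrow> \<not> (\<exists>p. pre_digraph.cycle Q p)"

datatype 'a arrow = Arr 'a | Opp 'a

definition doubled_quiver :: "('i, 'a) pre_digraph \<Rightarrow> ('i, 'a arrow) pre_digraph" where
  "doubled_quiver Q = \<lparr>
     verts = verts Q,
     arcs = Arr ` arcs Q \<union> Opp ` arcs Q,
     tail = (\<lambda>b. case b of Arr a \<Rightarrow> tail Q a | Opp a \<Rightarrow> head Q a),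
     head = (\<lambda>b. case b of Arr a \<Rightarrow> head Q a | Opp a \<Rightarrow> tail Q a) \<rparr>"

definition chain_quiver ::
    "nat \<Rightarrow> ('i, 'a) pre_digraph \<Rightarrow> ('i \<times> nat, 'a arrow \<times> nat) pre_digraph" where
  "chain_quiver l Q = \<lparr>
     verts = verts Q \<times> {1..l},
     arcs = Arr ` arcs Q \<times> {1..l} \<union> Opp ` arcs Q \<times> {1..<l},
     tail = (\<lambda>(b, n). case b of Arr a \<Rightarrow> (tail Q a, n) | Opp a \<Rightarrow> (head Q a, n)),
     head = (\<lambda>(b, n). case b of Arr a \<Rightarrow> (head Q a, n) | Opp a \<Rightarrow> (tail Q a, n + 1)) \<rparr>"

text \<open>
  The spaces of a representation are finite-dimensional subspaces of one ambient vector space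
  (of arbitrary dimension) with scalar multiplication \<open>s\<close>; they need not be independent in it.
  Only the values of a map on its source space matter, and only vertices and arrows
  of the quiver are constrained.
\<close>

record ('i, 'a, 'v) rep =
  vsp :: "'i \<Rightarrow> 'v set"
  lmap :: "'a \<Rightarrow> 'v \<Rightarrow> 'v"

definition linear_between ::
    "('k::field \<Rightarrow> 'v::ab_group_add \<Rightarrow> 'v) \<Rightarrow> 'v set \<Rightarrow> 'v set \<Rightarrow> ('v \<Rightarrow> 'v) \<Rightarrow> bool" where
  "linear_between s U U' f \<longleftrightarrow>
     (\<forall>u\<in>U. f u \<in> U') \<and>
     (\<forall>u\<in>U. \<forall>u'\<in>U. f (u + u') = f u + f u') \<and>
     (\<forall>c. \<forall>u\<in>U. f (s c u) = s c (f u))"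

definition quiver_rep ::
    "('k::field \<Rightarrow> 'v::ab_group_add \<Rightarrow> 'v) \<Rightarrow> ('i, 'a) pre_digraph \<Rightarrow> ('i, 'a, 'v) rep \<Rightarrow> bool" where
  "quiver_rep s G R \<longleftrightarrow>
     (\<forall>i\<in>verts G. module.subspace s (vsp R i) \<and> (\<exists>B. finite B \<and> module.span s B = vsp R i)) \<and>
     (\<forall>a\<in>arcs G. linear_between s (vsp R (tail G a)) (vsp R (head G a)) (lmap R a))"

definition has_dim_vector ::
    "('k::field \<Rightarrow> 'v::ab_group_add \<Rightarrow> 'v) \<Rightarrow> ('i, 'a) pre_digraph \<Rightarrow> ('i, 'a, 'v) rep
      \<Rightarrow> ('i \<Rightarrow> nat) \<Rightarrow> bool" where
  "has_dim_vector s G R d \<longleftrightarrow> (\<forall>i\<in>verts G. vector_space.dim s (vsp R i) = d i)"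

definition subrep ::
    "('k::field \<Rightarrow> 'v::ab_group_add \<Rightarrow> 'v) \<Rightarrow> ('i, 'a) pre_digraph \<Rightarrow> ('i, 'a, 'v) rep
      \<Rightarrow> ('i \<Rightarrow> 'v set) \<Rightarrow> bool" where
  "subrep s G R W \<longleftrightarrow>
     (\<forall>i\<in>verts G. module.subspace s (W i) \<and> W i \<subseteq> vsp R i) \<and>
     (\<forall>a\<in>arcs G. \<forall>w\<in>W (tail G a). lmap R a w \<in> W (head G a))"

definition proper_nonzero_subrep ::
    "('k::field \<Rightarrow> 'v::ab_group_add \<Rightarrow> 'v) \<Rightarrow> ('i, 'a) pre_digraph \<Rightarrow> ('i, 'a, 'v) rep
      \<Rightarrow> ('i \<Rightarrow> 'v set) \<Rightarrow> bool" where
  "proper_nonzero_subrep s G R W \<longleftrightarrow>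
     subrep s G R W \<and> (\<exists>i\<in>verts G. W i \<noteq> {0}) \<and> (\<exists>i\<in>verts G. W i \<noteq> vsp R i)"

definition slope ::
    "('k::field \<Rightarrow> 'v::ab_group_add \<Rightarrow> 'v) \<Rightarrow> ('i, 'a) pre_digraph \<Rightarrow> ('i \<Rightarrow> int)
      \<Rightarrow> ('i \<Rightarrow> 'v set) \<Rightarrow> rat" where
  "slope s G \<eta> W =
     of_int (\<Sum>i\<in>verts G. \<eta> i * int (vector_space.dim s (W i))) /
     of_nat (\<Sum>i\<in>verts G. vector_space.dim s (W i))"

definition semistable ::
    "('k::field \<Rightarrow> 'v::ab_group_add \<Rightarrow> 'v) \<Rightarrow> ('i, 'a) pre_digraph \<Rightarrow> ('i \<Rightarrow> int)
      \<Rightarrow> ('i, 'a, 'v) rep \<Rightarrow> bool" where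
  "semistable s G \<eta> R \<longleftrightarrow>
     (\<forall>W. proper_nonzero_subrep s G R W \<longrightarrow> slope s G \<eta> W \<le> slope s G \<eta> (vsp R))"

definition stable ::
    "('k::field \<Rightarrow> 'v::ab_group_add \<Rightarrow> 'v) \<Rightarrow> ('i, 'a) pre_digraph \<Rightarrow> ('i \<Rightarrow> int)
      \<Rightarrow> ('i, 'a, 'v) rep \<Rightarrow> bool" where
  "stable s G \<eta> R \<longleftrightarrow>
     (\<forall>W. proper_nonzero_subrep s G R W \<longrightarrow> slope s G \<eta> W < slope s G \<eta> (vsp R))"

definition generic :: "('i, 'a) pre_digraph \<Rightarrow> ('i \<Rightarrow> nat) \<Rightarrow> ('i \<Rightarrow> int) \<Rightarrow> bool" where
  "generic Q d \<theta> \<longleftrightarrow>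
     (\<Sum>i\<in>verts Q. \<theta> i * int (d i)) = 0 \<and>
     (\<forall>e::'i \<Rightarrow> nat. (\<forall>i\<in>verts Q. e i \<le> d i) \<and>
        (\<exists>i\<in>verts Q. e i \<noteq> 0) \<and> (\<exists>i\<in>verts Q. e i \<noteq> d i) \<longrightarrow>
        (\<Sum>i\<in>verts Q. \<theta> i * int (e i)) \<noteq> 0)"

definition nakajima_rep ::
    "('k::field \<Rightarrow> 'v::ab_group_add \<Rightarrow> 'v) \<Rightarrow> ('i, 'a) pre_digraph \<Rightarrow> ('i, 'a arrow, 'v) rep \<Rightarrow> bool" where
  "nakajima_rep s Q R \<longleftrightarrow>
     quiver_rep s (doubled_quiver Q) R \<and>
     (\<forall>i\<in>verts Q. \<forall>v\<in>vsp R i.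
        (\<Sum>a | a \<in> arcs Q \<and> head Q a = i. lmap R (Arr a) (lmap R (Opp a) v)) -
        (\<Sum>a | a \<in> arcs Q \<and> tail Q a = i. lmap R (Opp a) (lmap R (Arr a) v)) = 0)"

definition quiver_chain ::
    "('k::field \<Rightarrow> 'v::ab_group_add \<Rightarrow> 'v) \<Rightarrow> nat \<Rightarrow> ('i, 'a) pre_digraph
      \<Rightarrow> ('i \<times> nat, 'a arrow \<times> nat, 'v) rep \<Rightarrow> bool" where
  "quiver_chain s l Q C \<longleftrightarrow>
     quiver_rep s (chain_quiver l Q) C \<and>
     (\<forall>i\<in>verts Q. \<forall>n\<in>{1..<l}. \<forall>v\<in>vsp C (i, n).
        (\<Sum>a | a \<in> arcs Q \<and> head Q a = i. lmap C (Arr a, n + 1) (lmap C (Opp a, n) v)) -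
        (\<Sum>a | a \<in> arcs Q \<and> tail Q a = i. lmap C (Opp a, n) (lmap C (Arr a, n) v)) = 0)"

text \<open>
  The direct sum \<open>V\<^sub>i\<close> of the \<open>V\<^sub>i\<^sub>,\<^sub>n\<close> is external: it consists of the
  functions \<open>f :: nat \<Rightarrow> 'v\<close> with \<open>f n \<in> V\<^sub>i\<^sub>,\<^sub>n\<close> for \<open>1 \<le> n \<le> l\<close> and \<open>f n = 0\<close> otherwise,
  with pointwise operations.
\<close>

definition pointwise_scale :: "('k \<Rightarrow> 'v \<Rightarrow> 'v) \<Rightarrow> 'k \<Rightarrow> (nat \<Rightarrow> 'v) \<Rightarrow> nat \<Rightarrow> 'v" where
  "pointwise_scale s c f = (\<lambda>n. s c (f n))"

definition collapse ::
    "nat \<Rightarrow> ('i \<times> nat, 'a arrow \<times> nat, 'v::zero) rep \<Rightarrow> ('i, 'a arrow, nat \<Rightarrow> 'v) rep" where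
  "collapse l C = \<lparr>
     vsp = (\<lambda>i. {f. (\<forall>n\<in>{1..l}. f n \<in> vsp C (i, n)) \<and> (\<forall>n. n \<notin> {1..l} \<longrightarrow> f n = 0)}),
     lmap = (\<lambda>b f n. case b of
        Arr a \<Rightarrow> if n \<in> {1..l} then lmap C (Arr a, n) (f n) else 0
      | Opp a \<Rightarrow> if n \<in> {2..l} then lmap C (Opp a, n - 1) (f (n - 1)) else 0) \<rparr>"

lemma vector_space_pointwise_scale:
  assumes "vector_space s"
  shows "vector_space (pointwise_scale s)"
proof -
  interpret vector_space s by fact
  show ?thesis
    by unfold_locales
      (auto simp: pointwise_scale_def fun_eq_iff scale_right_distrib scale_left_distrib)
qed

lemma finite_span_collapse:
  assumes s: "vector_space s"
    and sp: "\<And>n. n \<in> {1..l} \<Longrightarrow> module.subspace s (vsp C (i, n)) \<and>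
               (\<exists>B. finite B \<and> module.span s B = vsp C (i, n))"
  shows "module.subspace (pointwise_scale s) (vsp (collapse l C) i) \<and>
         (\<exists>B. finite B \<and> module.span (pointwise_scale s) B = vsp (collapse l C) i)"
proof -
  interpret vector_space s by fact
  interpret P: vector_space "pointwise_scale s"
    using s by (rule vector_space_pointwise_scale)
  have sub: "P.subspace (vsp (collapse l C) i)"
    using sp unfolding P.subspace_def collapse_def pointwise_scale_def
    by (auto simp: subspace_def)
  define e where "e n v = (\<lambda>m::nat. if m = n then v else 0)" for n and v :: 'b
  obtain B where B: "finite (B n)" "span (B n) = vsp C (i, n)" if "n \<in> {1..l}" for n
    using sp by metis
  define E where "E = (\<Union>n\<in>{1..l}. e n ` B n)"
  have "E \<subseteq> vsp (collapse l C) i"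
  proof
    fix f assume "f \<in> E"
    then obtain n v where nv: "n \<in> {1..l}" "v \<in> B n" "f = e n v" by (auto simp: E_def)
    have "v \<in> vsp C (i, n)" using B(2)[OF nv(1)] nv(2) span_base by blast
    moreover have "0 \<in> vsp C (i, m)" if "m \<in> {1..l}" for m
      using sp[OF that] subspace_0 by blast
    ultimately show "f \<in> vsp (collapse l C) i"
      using nv(1) by (auto simp: collapse_def nv(3) e_def)
  qed
  then have "P.span E \<subseteq> vsp (collapse l C) i"
    using sub by (rule P.span_minimal)
  moreover have "vsp (collapse l C) i \<subseteq> P.span E"
  proof
    fix f assume f: "f \<in> vsp (collapse l C) i"
    have e: "e n v \<in> P.span E" if n: "n \<in> {1..l}" and v: "v \<in> span (B n)" for n v
      using v
    proof (induction rule: span_induct_alt)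
      case base
      have "e n 0 = 0" by (auto simp: e_def)
      then show ?case using P.span_zero[of E] by metis
    next
      case (step c x y)
      have "e n (s c x + y) = pointwise_scale s c (e n x) + e n y"
        by (auto simp: e_def pointwise_scale_def)
      moreover have "e n x \<in> P.span E"
        using n step by (intro P.span_base) (auto simp: E_def)
      ultimately show ?case using step P.span_add P.span_scale by metis
    qed
    have "f = (\<Sum>n\<in>{1..l}. e n (f n))"
    proof
      fix m
      have "(\<Sum>n\<in>{1..l}. e n (f n)) m = (\<Sum>n\<in>{1..l}. e n (f n) m)"
        by (induction rule: finite_induct[OF finite_atLeastAtMost[of 1 l]]) auto
      also have "\<dots> = f m"
        using f by (auto simp: e_def collapse_def)
      finally show "f m = (\<Sum>n\<in>{1..l}. e n (f n)) m" by simp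
    qed
    moreover have "(\<Sum>n\<in>{1..l}. e n (f n)) \<in> P.span E"
      using f B(2) by (intro P.span_sum e) (auto simp: collapse_def)
    ultimately show "f \<in> P.span E" by simp
  qed
  moreover have "finite E" using B(1) by (auto simp: E_def)
  ultimately show ?thesis using sub by blast
qed

lemma sum_fun_apply: "(\<Sum>a\<in>A. g a) m = (\<Sum>a\<in>A. g a m)"
  for g :: "'a \<Rightarrow> nat \<Rightarrow> 'v::ab_group_add"
  by (induction A rule: infinite_finite_induct) auto

lemma nakajima_rep_collapse:
  fixes s :: "'k::field \<Rightarrow> 'v::ab_group_add \<Rightarrow> 'v"
  assumes s: "vector_space s" and Q: "fin_digraph Q" and C: "quiver_chain s l Q C"
  shows "nakajima_rep (pointwise_scale s) Q (collapse l C)"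
proof -
  interpret vector_space s by fact
  interpret Q: fin_digraph Q by fact
  have sp: "subspace (vsp C (i, n)) \<and> (\<exists>B. finite B \<and> span B = vsp C (i, n))"
    if "i \<in> verts Q" "n \<in> {1..l}" for i n
    using C that by (auto simp: quiver_chain_def quiver_rep_def chain_quiver_def)
  have X: "linear_between s (vsp C (tail Q a, n)) (vsp C (head Q a, n)) (lmap C (Arr a, n))"
    if "a \<in> arcs Q" "n \<in> {1..l}" for a n
  proof -
    have "(Arr a, n) \<in> arcs (chain_quiver l Q)" using that by (simp add: chain_quiver_def)
    then show ?thesis
      using C unfolding quiver_chain_def quiver_rep_def by (fastforce simp: chain_quiver_def)
  qed
  have Y: "linear_between s (vsp C (head Q a, n)) (vsp C (tail Q a, Suc n)) (lmap C (Opp a, n))"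
    if "a \<in> arcs Q" "n \<in> {1..<l}" for a n
  proof -
    have "(Opp a, n) \<in> arcs (chain_quiver l Q)" using that by (simp add: chain_quiver_def)
    then show ?thesis
      using C unfolding quiver_chain_def quiver_rep_def by (fastforce simp: chain_quiver_def)
  qed
  have X0: "lmap C (Arr a, n) 0 = 0" if "a \<in> arcs Q" "n \<in> {1..l}" for a n
    using X[OF that] subspace_0[of "vsp C (tail Q a, n)"] sp[of "tail Q a" n] that
    unfolding linear_between_def by (metis Q.tail_in_verts scale_zero_left)
  have Xc: "linear_between (pointwise_scale s) (vsp (collapse l C) (tail Q a))
              (vsp (collapse l C) (head Q a)) (lmap (collapse l C) (Arr a))"
    if "a \<in> arcs Q" for a
    using X[OF that]
    by (auto simp: linear_between_def collapse_def pointwise_scale_def fun_eq_iff)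
  have Yc: "linear_between (pointwise_scale s) (vsp (collapse l C) (head Q a))
              (vsp (collapse l C) (tail Q a)) (lmap (collapse l C) (Opp a))"
    if a: "a \<in> arcs Q" for a
  proof -
    have Y': "linear_between s (vsp C (head Q a, n - Suc 0)) (vsp C (tail Q a, n))
        (lmap C (Opp a, n - Suc 0))" if "2 \<le> n" "n \<le> l" for n
      using Y[OF a, of "n - 1"] that by (cases n) auto
    have "0 \<in> vsp C (tail Q a, n)" if "Suc 0 \<le> n" "n \<le> l" for n
      using sp[of "tail Q a" n] that a subspace_0 by auto
    moreover have "u (n - Suc 0) \<in> vsp C (head Q a, n - Suc 0)"
      if "\<forall>n\<in>{Suc 0..l}. u n \<in> vsp C (head Q a, n)" "2 \<le> n" "n \<le> l" for u n
      using that by (cases n) auto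
    ultimately show ?thesis
      using Y' unfolding linear_between_def
      by (intro conjI ballI allI ext)
        (simp_all add: collapse_def pointwise_scale_def)
  qed
  have "quiver_rep (pointwise_scale s) (doubled_quiver Q) (collapse l C)"
    unfolding quiver_rep_def
  proof (intro conjI ballI)
    fix i assume i: "i \<in> verts (doubled_quiver Q)"
    then have i: "i \<in> verts Q" by (simp add: doubled_quiver_def)
    show "module.subspace (pointwise_scale s) (vsp (collapse l C) i)"
      and "\<exists>B. finite B \<and> module.span (pointwise_scale s) B = vsp (collapse l C) i"
      using finite_span_collapse[OF s sp[OF i]] by auto
  next
    fix b assume "b \<in> arcs (doubled_quiver Q)"
    then show "linear_between (pointwise_scale s)
        (vsp (collapse l C) (tail (doubled_quiver Q) b))
        (vsp (collapse l C) (head (doubled_quiver Q) b)) (lmap (collapse l C) b)"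
      using Xc Yc by (auto simp: doubled_quiver_def)
  qed
  moreover have "(\<Sum>a | a \<in> arcs Q \<and> head Q a = i.
          lmap (collapse l C) (Arr a) (lmap (collapse l C) (Opp a) f)) -
        (\<Sum>a | a \<in> arcs Q \<and> tail Q a = i.
          lmap (collapse l C) (Opp a) (lmap (collapse l C) (Arr a) f)) = 0" (is "?L - ?R = 0")
    if i: "i \<in> verts Q" and f: "f \<in> vsp (collapse l C) i" for i f
  proof
    fix m
    show "(?L - ?R) m = 0 m"
    proof (cases "m \<in> {2..l}")
      case True
      then obtain n where m: "m = n + 1" and n: "n \<in> {1..<l}"
        by (cases m) auto
      have "f n \<in> vsp C (i, n)" using f n by (auto simp: collapse_def)
      then have "(\<Sum>a | a \<in> arcs Q \<and> head Q a = i. lmap C (Arr a, n + 1) (lmap C (Opp a, n) (f n))) -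
        (\<Sum>a | a \<in> arcs Q \<and> tail Q a = i. lmap C (Opp a, n) (lmap C (Arr a, n) (f n))) = 0"
        using C i n unfolding quiver_chain_def by blast
      then show ?thesis using n by (simp add: sum_fun_apply collapse_def m)
    next
      case False
      then show ?thesis
        by (auto simp: sum_fun_apply collapse_def X0 intro!: sum.neutral)
    qed
  qed
  ultimately show ?thesis unfolding nakajima_rep_def by blast
qed

end

theory Submission
  imports Defs
begin

text \<open>
  The collapsed representation \<open>V\<close> is graded by \<open>n\<close>: the maps \<open>X\<close> preserve the degree and the maps
  \<open>Y\<close> raise it by one. A subrepresentation of the chain is the same as a graded
  subrepresentation of \<open>V\<close>, so what has to be shown is that the other subrepresentations of \<open>V\<close>
  impose no further conditions on the slope.

  Let \<open>W\<close> be any subrepresentation of \<open>V\<close>, and let \<open>F\<^sub>n V\<close> be the part of \<open>V\<close> that lives in degrees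
  \<open>\<ge> n\<close>. Since \<open>X\<close> and \<open>Y\<close> are homogeneous of degrees \<open>0\<close> and \<open>1\<close>, they map \<open>F\<^sub>n V\<close> to \<open>F\<^sub>n V\<close> and to
  \<open>F\<^sub>n\<^sub>+\<^sub>1 V\<close>, so they act on the associated graded object of \<open>W\<close>, whose degree \<open>n\<close> part
  \<open>(W \<inter> F\<^sub>n V) / (W \<inter> F\<^sub>n\<^sub>+\<^sub>1 V)\<close> is the space of degree \<open>n\<close> leading terms of elements of \<open>W\<close>.
  The leading terms thus form a subrepresentation of the chain (\<open>subrep_leading_terms\<close>), and by
  rank-nullity, applied once for each degree, they have the same total dimension as \<open>W\<close> at every
  vertex of \<open>Q\<close> (\<open>dim_eq_sum_leading_terms\<close>).

  As \<open>\<theta>\<^sup>l\<close> does not depend on the degree, the slope depends only on these total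
  dimensions, and so does being nonzero and being proper. Passing to leading terms in one direction
  and taking direct sums in the other (\<open>subrep_collapse\<close>) therefore shows that the proper nonzero
  subrepresentations on the two sides have exactly the same slopes, which gives both equivalences.
\<close>

section \<open>Dimensions inside finitely spanned subspaces\<close>

text \<open>
  The ambient space may be infinite-dimensional, so rank-nullity is proved for a subspace of a
  finitely spanned space: extend a basis \<open>A\<close> of the kernel to a basis \<open>B\<close>; then \<open>f\<close> maps \<open>B - A\<close>
  bijectively to a basis of the image.
\<close>
lemma rank_nullity_on:
  assumes f: "Vector_Spaces.linear s1 s2 f"
    and S: "module.subspace s1 S" and T: "finite T" "S \<subseteq> module.span s1 T"
  shows "vector_space.dim s1 S =
    vector_space.dim s2 (f ` S) + vector_space.dim s1 {x \<in> S. f x = 0}"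
proof -
  interpret vs1: vector_space s1 using f by (simp add: Vector_Spaces.linear_def)
  interpret vs2: vector_space s2 using f by (simp add: Vector_Spaces.linear_def)
  interpret vector_space_pair s1 s2 by unfold_locales
  interpret f: Vector_Spaces.linear s1 s2 f by fact
  define K where "K = {x \<in> S. f x = 0}"
  obtain A where A: "A \<subseteq> K" "vs1.independent A" "K \<subseteq> vs1.span A" "card A = vs1.dim K"
    by (rule vs1.basis_exists)
  obtain B where B: "A \<subseteq> B" "B \<subseteq> S" "vs1.independent B" "S \<subseteq> vs1.span B"
    using vs1.maximal_independent_subset_extend[of A S] A(1,2) by (auto simp: K_def)
  have fin: "finite B"
    using vs1.independent_span_bound[OF T(1) B(3)] B(2) T(2) by auto
  \<comment> \<open>A kernel element in the span of \<open>B - A\<close> has one expansion over \<open>A\<close> and one over \<open>B - A\<close>;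
    both are its expansion over \<open>B\<close>, so all coefficients vanish.\<close>
  have "x = 0" if x: "x \<in> vs1.span (B - A)" and fx: "f x = 0" for x
  proof -
    have "x \<in> S" using x B(2) S vs1.span_minimal[of "B - A" S] by blast
    then have xA: "x \<in> vs1.span A" using A(3) fx by (auto simp: K_def)
    have xB: "x \<in> vs1.span B" using xA B(1) vs1.span_mono by blast
    have "vs1.representation B x = vs1.representation A x"
      "vs1.representation B x = vs1.representation (B - A) x"
      using vs1.representation_extend[OF B(3) xA B(1)] vs1.representation_extend[OF B(3) x] by auto
    then have "vs1.representation B x b = 0" for b
      using vs1.representation_ne_zero[of A x b] vs1.representation_ne_zero[of "B - A" x b]
      by fastforce
    then show "x = 0" using vs1.sum_nonzero_representation_eq[OF B(3) xB] by simp
  qed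
  then have inj: "inj_on f (vs1.span (B - A))"
    by (subst f.inj_on_iff_eq_0) (auto simp: vs1.subspace_span)
  have "vs2.independent (f ` (B - A))"
    by (rule linear_independent_injective_image[OF f _ inj])
      (use B(3) vs1.independent_mono in blast)
  moreover have "f ` S \<subseteq> vs2.span (f ` (B - A))"
  proof -
    have "f ` B \<subseteq> insert 0 (f ` (B - A))" using A(1) by (auto simp: K_def)
    then have "vs2.span (f ` B) \<subseteq> vs2.span (f ` (B - A))"
      by (metis vs2.span_insert_0 vs2.span_mono)
    then show ?thesis using B(4) f.span_image[of B] by blast
  qed
  moreover have "f ` (B - A) \<subseteq> f ` S" using B(2) by blast
  ultimately have "vs2.dim (f ` S) = card (f ` (B - A))"
    by (metis vs2.basis_card_eq_dim)
  also have "\<dots> = card (B - A)"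
    using inj vs1.span_superset by (intro card_image) (rule inj_on_subset)
  finally have "vs2.dim (f ` S) = card B - card A"
    using B(1) fin by (simp add: card_Diff_subset finite_subset)
  moreover have "vs1.dim S = card B" using B vs1.basis_card_eq_dim[of B S] by simp
  moreover have "card A \<le> card B" using B(1) fin by (rule card_mono[rotated])
  ultimately show ?thesis using A(4) by (simp add: K_def)
qed

lemma (in vector_space) dim_subspace_mono_on:
  assumes "U \<subseteq> S" and T: "finite T" "S \<subseteq> span T"
  shows "dim U \<le> dim S"
proof -
  obtain B where B: "B \<subseteq> S" "independent B" "S \<subseteq> span B" "card B = dim S"
    by (rule basis_exists)
  have "finite B" using independent_span_bound[OF T(1) B(2)] B(1) T(2) by auto
  then show ?thesis using dim_le_card[of U B] B assms(1) by auto
qed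

lemma (in vector_space) subspace_dim_equal_on:
  assumes U: "subspace U" and US: "U \<subseteq> S" and T: "finite T" "S \<subseteq> span T" and d: "dim U = dim S"
  shows "U = S"
proof -
  obtain A where A: "A \<subseteq> U" "independent A" "U \<subseteq> span A" "card A = dim U"
    by (rule basis_exists)
  obtain B where B: "A \<subseteq> B" "B \<subseteq> S" "independent B" "S \<subseteq> span B"
    using maximal_independent_subset_extend[of A S] subset_trans[OF A(1) US] A(2) by metis
  have "finite B" using independent_span_bound[OF T(1) B(3)] B(2) T(2) by auto
  moreover have "card B = card A" using basis_card_eq_dim[of B S] B A(4) d by simp
  ultimately have "A = B" using B(1) by (metis card_subset_eq)
  then have "S \<subseteq> U" using B(4) A(1) U span_minimal[of A U] by blast
  then show ?thesis using US by blast
qed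

text \<open>
  Whether a subrepresentation is proper and nonzero can be read off from its dimension vector; this
  lets both properties be transferred between subrepresentations that are related only through
  their dimensions.
\<close>
lemma proper_nonzero_subrep_iff_dim:
  assumes s: "vector_space s" and R: "quiver_rep s G R"
  shows "proper_nonzero_subrep s G R W \<longleftrightarrow> subrep s G R W \<and>
    (\<exists>i\<in>verts G. vector_space.dim s (W i) \<noteq> 0) \<and>
    (\<exists>i\<in>verts G. vector_space.dim s (W i) \<noteq> vector_space.dim s (vsp R i))"
proof -
  interpret vector_space s by fact
  have *: "(W i = {0}) = (dim (W i) = 0)" "(W i = vsp R i) = (dim (W i) = dim (vsp R i))"
    if W: "subrep s G R W" and i: "i \<in> verts G" for i
  proof -
    obtain T where T: "finite T" "span T = vsp R i" using R i by (auto simp: quiver_rep_def)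
    have Wi: "subspace (W i)" "W i \<subseteq> vsp R i" using W i by (auto simp: subrep_def)
    have d0: "dim {0} = 0" using dim_unique[of "{}" "{0}" 0] independent_empty by simp
    have 0: "{0} \<subseteq> W i" using Wi(1) subspace_0 by blast
    show "(W i = {0}) = (dim (W i) = 0)"
      using subspace_dim_equal_on[OF subspace_single_0 0 T(1)] d0 Wi(2) T(2) by auto
    show "(W i = vsp R i) = (dim (W i) = dim (vsp R i))"
      using subspace_dim_equal_on[OF Wi T(1)] T(2) by auto
  qed
  show ?thesis
    unfolding proper_nonzero_subrep_def by (intro conj_cong refl bex_cong arg_cong[of _ _ Not] *)
qed

section \<open>Leading terms\<close>

text \<open>
  This is the degree \<open>n\<close> part of the associated graded space of \<open>S\<close> for the filtration by order of
  vanishing, with the quotient \<open>(S \<inter> F\<^sub>n) / (S \<inter> F\<^sub>n\<^sub>+\<^sub>1)\<close> realised as the image of evaluation at \<open>n\<close>.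
  As the minimal degree is not required to be attained, \<open>0\<close> is included.
\<close>
definition leading_terms :: "nat \<Rightarrow> (nat \<Rightarrow> 'v::zero) set \<Rightarrow> 'v set" where
  "leading_terms n S = {f n |f. f \<in> S \<and> (\<forall>m<n. f m = 0)}"

lemma linear_evaluation:
  assumes "vector_space s"
  shows "Vector_Spaces.linear (pointwise_scale s) s (\<lambda>f. f n)"
proof -
  interpret vector_space s by fact
  interpret P: vector_space "pointwise_scale s"
    using assms by (rule vector_space_pointwise_scale)
  show ?thesis by unfold_locales (auto simp: pointwise_scale_def)
qed

lemma subspace_vanishing_below:
  assumes s: "vector_space s" and S: "module.subspace (pointwise_scale s) S"
  shows "module.subspace (pointwise_scale s) {f \<in> S. \<forall>m<n. f m = 0}"
proof -
  interpret vector_space s by fact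
  interpret P: vector_space "pointwise_scale s"
    using s by (rule vector_space_pointwise_scale)
  show ?thesis using S unfolding P.subspace_def by (auto simp: pointwise_scale_def)
qed

lemma leading_terms_eq_image: "leading_terms n S = (\<lambda>f. f n) ` {f \<in> S. \<forall>m<n. f m = 0}"
  by (auto simp: leading_terms_def)

lemma subspace_leading_terms:
  assumes s: "vector_space s" and S: "module.subspace (pointwise_scale s) S"
  shows "module.subspace s (leading_terms n S)"
proof -
  interpret Vector_Spaces.linear "pointwise_scale s" s "\<lambda>f. f n"
    using s by (rule linear_evaluation)
  show ?thesis
    unfolding leading_terms_eq_image by (intro subspace_image subspace_vanishing_below s S)
qed

text \<open>
  Evaluation at \<open>n\<close> maps \<open>S \<inter> F\<^sub>n\<close> onto the leading terms of degree \<open>n\<close>, with kernel \<open>S \<inter> F\<^sub>n\<^sub>+\<^sub>1\<close>.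
  Rank-nullity for each step of the filtration makes the sum telescope from \<open>F\<^sub>1\<close>, which contains
  \<open>S\<close>, to \<open>F\<^sub>l\<^sub>+\<^sub>1\<close>, which meets it in \<open>0\<close>.
\<close>
lemma dim_eq_sum_leading_terms:
  assumes s: "vector_space s" and S: "module.subspace (pointwise_scale s) S"
    and T: "finite T" "S \<subseteq> module.span (pointwise_scale s) T"
    and supp: "\<And>f n. f \<in> S \<Longrightarrow> n \<notin> {1..l} \<Longrightarrow> f n = 0"
  shows "vector_space.dim (pointwise_scale s) S = (\<Sum>n=1..l. vector_space.dim s (leading_terms n S))"
proof -
  interpret vector_space s by fact
  interpret P: vector_space "pointwise_scale s"
    using s by (rule vector_space_pointwise_scale)
  define F where "F n = {f \<in> S. \<forall>m<n. f m = 0}" for n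
  have step: "P.dim (F n) = dim (leading_terms n S) + P.dim (F (Suc n))" for n
  proof -
    have "F (Suc n) = {f \<in> F n. f n = 0}" by (auto simp: F_def less_Suc_eq)
    moreover have "F n \<subseteq> P.span T" using T(2) by (auto simp: F_def)
    ultimately show ?thesis
      using rank_nullity_on[OF linear_evaluation[OF s] subspace_vanishing_below[OF s S] T(1)]
      by (simp add: F_def leading_terms_eq_image)
  qed
  have sum: "P.dim (F 1) = (\<Sum>n=1..k. dim (leading_terms n S)) + P.dim (F (Suc k))" for k
  proof (induction k)
    case (Suc k)
    then show ?case using step[of "Suc k"] by simp
  qed simp
  have F1: "F 1 = S" using supp[of _ 0] by (auto simp: F_def)
  have "f = 0" if "f \<in> F (Suc l)" for f
  proof
    fix n show "f n = 0 n"
      using that supp[of f n] by (cases "n \<le> l") (auto simp: F_def)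
  qed
  then have Fl: "F (Suc l) = {0}" using S P.subspace_0[of S] by (auto simp: F_def)
  have "P.dim {0} = 0"
    by (rule P.dim_unique[of "{}"]) (simp_all add: P.independent_empty)
  then show ?thesis using sum[of l] by (simp only: F1 Fl add_0_right)
qed

section \<open>Graded and ungraded subrepresentations\<close>

lemma leading_terms_collapse:
  assumes n: "n \<in> {1..l}" and z: "\<And>m. m \<in> {1..l} \<Longrightarrow> 0 \<in> vsp D (i, m)"
  shows "leading_terms n (vsp (collapse l D) i) = vsp D (i, n)"
proof
  show "leading_terms n (vsp (collapse l D) i) \<subseteq> vsp D (i, n)"
    using n by (auto simp: leading_terms_def collapse_def)
  show "vsp D (i, n) \<subseteq> leading_terms n (vsp (collapse l D) i)"
  proof
    fix v assume v: "v \<in> vsp D (i, n)"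
    have "(\<lambda>m. if m = n then v else 0) \<in> vsp (collapse l D) i"
      using v n z by (auto simp: collapse_def)
    then show "v \<in> leading_terms n (vsp (collapse l D) i)"
      unfolding leading_terms_def by (auto intro!: exI[of _ "\<lambda>m. if m = n then v else 0"])
  qed
qed

text \<open>
  A direct sum recovers its summands as spaces of leading terms, so its dimension is an instance of
  the count above. The chain \<open>C\<close> only serves to bound \<open>D\<close> by finite-dimensional spaces.
\<close>
lemma dim_collapse:
  fixes C D :: "('i \<times> nat, 'a arrow \<times> nat, 'v::ab_group_add) rep"
  assumes s: "vector_space s"
    and D: "\<And>n. n \<in> {1..l} \<Longrightarrow> module.subspace s (vsp D (i, n)) \<and> vsp D (i, n) \<subseteq> vsp C (i, n)"
    and C: "\<And>n. n \<in> {1..l} \<Longrightarrow> module.subspace s (vsp C (i, n)) \<and>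
               (\<exists>B. finite B \<and> module.span s B = vsp C (i, n))"
  shows "module.subspace (pointwise_scale s) (vsp (collapse l D) i)"
    and "vector_space.dim (pointwise_scale s) (vsp (collapse l D) i) =
      (\<Sum>n=1..l. vector_space.dim s (vsp D (i, n)))"
proof -
  interpret vector_space s by fact
  interpret P: vector_space "pointwise_scale s"
    using s by (rule vector_space_pointwise_scale)
  show sub: "P.subspace (vsp (collapse l D) i)"
    using D unfolding P.subspace_def collapse_def pointwise_scale_def
    by (auto simp: subspace_def)
  obtain T where T: "finite T" "P.span T = vsp (collapse l C) i"
    using finite_span_collapse[OF s C] by blast
  have "vsp (collapse l D) i \<subseteq> P.span T"
    unfolding T(2) using D by (fastforce simp: collapse_def)
  then have "P.dim (vsp (collapse l D) i) = (\<Sum>n=1..l. dim (leading_terms n (vsp (collapse l D) i)))"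
    by (intro dim_eq_sum_leading_terms[OF s sub T(1)]) (auto simp: collapse_def)
  also have "\<dots> = (\<Sum>n=1..l. dim (vsp D (i, n)))"
    using D subspace_0 by (intro sum.cong refl arg_cong[of _ _ dim] leading_terms_collapse) auto
  finally show "P.dim (vsp (collapse l D) i) = (\<Sum>n=1..l. dim (vsp D (i, n)))" .
qed

lemma subrep_chain_quiver_iff:
  "subrep s (chain_quiver l Q) C W \<longleftrightarrow>
    (\<forall>i\<in>verts Q. \<forall>n\<in>{1..l}. module.subspace s (W (i, n)) \<and> W (i, n) \<subseteq> vsp C (i, n)) \<and>
    (\<forall>a\<in>arcs Q. \<forall>n\<in>{1..l}. \<forall>w\<in>W (tail Q a, n). lmap C (Arr a, n) w \<in> W (head Q a, n)) \<and>
    (\<forall>a\<in>arcs Q. \<forall>n\<in>{1..<l}. \<forall>w\<in>W (head Q a, n). lmap C (Opp a, n) w \<in> W (tail Q a, n + 1))"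
  unfolding subrep_def chain_quiver_def by (simp add: ball_Un split_paired_Ball_Sigma)

lemma subrep_doubled_quiver_iff:
  "subrep s (doubled_quiver Q) R W \<longleftrightarrow>
    (\<forall>i\<in>verts Q. module.subspace s (W i) \<and> W i \<subseteq> vsp R i) \<and>
    (\<forall>a\<in>arcs Q. \<forall>w\<in>W (tail Q a). lmap R (Arr a) w \<in> W (head Q a)) \<and>
    (\<forall>a\<in>arcs Q. \<forall>w\<in>W (head Q a). lmap R (Opp a) w \<in> W (tail Q a))"
  unfolding subrep_def doubled_quiver_def by (simp add: ball_Un)

text \<open>
  The direct sum of a family \<open>W\<close> is written as the collapse of the chain with its spaces replaced
  by \<open>W\<close>.
\<close>
lemma subrep_collapse:
  assumes s: "vector_space s" and Q: "wf_digraph Q"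
    and C: "quiver_rep s (chain_quiver l Q) C"
    and W: "subrep s (chain_quiver l Q) C W"
  shows "subrep (pointwise_scale s) (doubled_quiver Q) (collapse l C)
    (vsp (collapse l (C\<lparr>vsp := W\<rparr>)))"
proof -
  interpret vector_space s by fact
  interpret Q: wf_digraph Q by fact
  have W1: "subspace (W (i, n))" "W (i, n) \<subseteq> vsp C (i, n)" if "i \<in> verts Q" "n \<in> {1..l}" for i n
    using W that unfolding subrep_chain_quiver_iff by blast+
  have WX: "lmap C (Arr a, n) w \<in> W (head Q a, n)"
    if "a \<in> arcs Q" "n \<in> {1..l}" "w \<in> W (tail Q a, n)" for a n w
    using W that unfolding subrep_chain_quiver_iff by blast
  have WY: "lmap C (Opp a, n - 1) w \<in> W (tail Q a, n)"
    if "a \<in> arcs Q" "n \<in> {2..l}" "w \<in> W (head Q a, n - 1)" for a n w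
  proof -
    have "n - 1 \<in> {1..<l}" "n - 1 + 1 = n" using that(2) by auto
    then show ?thesis using W that unfolding subrep_chain_quiver_iff by metis
  qed
  have sp: "subspace (vsp C (i, n)) \<and> (\<exists>B. finite B \<and> span B = vsp C (i, n))"
    if "i \<in> verts Q" "n \<in> {1..l}" for i n
    using C that by (auto simp: quiver_rep_def chain_quiver_def)
  have "module.subspace (pointwise_scale s) (vsp (collapse l (C\<lparr>vsp := W\<rparr>)) i)"
    if "i \<in> verts Q" for i
    using W1 sp that by (intro dim_collapse(1)[OF s, where C = C]) auto
  moreover have "vsp (collapse l (C\<lparr>vsp := W\<rparr>)) i \<subseteq> vsp (collapse l C) i" if "i \<in> verts Q" for i
    using W1(2)[OF that] by (fastforce simp: collapse_def)
  moreover have "lmap (collapse l C) (Arr a) f \<in> vsp (collapse l (C\<lparr>vsp := W\<rparr>)) (head Q a)"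
    if "a \<in> arcs Q" "f \<in> vsp (collapse l (C\<lparr>vsp := W\<rparr>)) (tail Q a)" for a f
    using WX that by (auto simp: collapse_def)
  moreover have "lmap (collapse l C) (Opp a) f \<in> vsp (collapse l (C\<lparr>vsp := W\<rparr>)) (tail Q a)"
    if a: "a \<in> arcs Q" and f: "f \<in> vsp (collapse l (C\<lparr>vsp := W\<rparr>)) (head Q a)" for a f
  proof -
    have "lmap (collapse l C) (Opp a) f n \<in> W (tail Q a, n)" if n: "n \<in> {1..l}" for n
    proof (cases "n = 1")
      case True
      \<comment> \<open>No map \<open>Y\<close> ends in degree \<open>1\<close>, so this component of the image is \<open>0\<close>.\<close>
      then show ?thesis using W1(1)[of "tail Q a" n] a n subspace_0 by (simp add: collapse_def)
    next
      case False
      then have "n \<in> {2..l}" "n - 1 \<in> {1..l}" using n by auto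
      then show ?thesis using WY[OF a] f by (simp add: collapse_def)
    qed
    then show ?thesis by (simp add: collapse_def)
  qed
  ultimately show ?thesis unfolding subrep_doubled_quiver_iff by blast
qed

text \<open>
  A homogeneous map sends the leading term of \<open>f\<close> to the leading term of the image of \<open>f\<close>, or to \<open>0\<close>
  if the order of vanishing jumps. The subspaces \<open>W i\<close> are stable under the collapsed maps, so
  their leading terms are stable under the components of these maps.
\<close>
lemma subrep_leading_terms:
  assumes s: "vector_space s" and Q: "wf_digraph Q"
    and C: "quiver_rep s (chain_quiver l Q) C"
    and W: "subrep (pointwise_scale s) (doubled_quiver Q) (collapse l C) W"
  shows "subrep s (chain_quiver l Q) C (\<lambda>(i, n). leading_terms n (W i))"
proof -
  interpret vector_space s by fact
  interpret Q: wf_digraph Q by fact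
  have W1: "module.subspace (pointwise_scale s) (W i)" "W i \<subseteq> vsp (collapse l C) i"
    if "i \<in> verts Q" for i
    using W that unfolding subrep_doubled_quiver_iff by blast+
  have zero: "lmap C b 0 = 0" if b: "b \<in> arcs (chain_quiver l Q)"
    and t: "tail (chain_quiver l Q) b \<in> verts (chain_quiver l Q)" for b
  proof -
    have "0 \<in> vsp C (tail (chain_quiver l Q) b)"
      using C t subspace_0 by (auto simp: quiver_rep_def)
    then show ?thesis
      using C b scale_zero_left unfolding quiver_rep_def linear_between_def by metis
  qed
  have X0: "lmap C (Arr a, n) 0 = 0" if "a \<in> arcs Q" "n \<in> {1..l}" for a n
    using that by (intro zero) (auto simp: chain_quiver_def)
  have Y0: "lmap C (Opp a, n) 0 = 0" if "a \<in> arcs Q" "n \<in> {1..<l}" for a n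
    using that by (intro zero) (auto simp: chain_quiver_def)
  have "subspace (leading_terms n (W i))" if "i \<in> verts Q" for i n
    using subspace_leading_terms[OF s W1(1)[OF that]] .
  moreover have "leading_terms n (W i) \<subseteq> vsp C (i, n)" if "i \<in> verts Q" "n \<in> {1..l}" for i n
    using W1(2)[OF that(1)] that(2) by (auto simp: leading_terms_def collapse_def)
  moreover have "lmap C (Arr a, n) w \<in> leading_terms n (W (head Q a))"
    if a: "a \<in> arcs Q" and n: "n \<in> {1..l}" and w: "w \<in> leading_terms n (W (tail Q a))" for a n w
  proof -
    obtain f where f: "f \<in> W (tail Q a)" "\<forall>m<n. f m = 0" "w = f n"
      using w by (auto simp: leading_terms_def)
    define g where "g = lmap (collapse l C) (Arr a) f"
    have "g \<in> W (head Q a)"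
      using W a f(1) unfolding subrep_doubled_quiver_iff g_def by blast
    moreover have "\<forall>m<n. g m = 0" "g n = lmap C (Arr a, n) w"
      using X0[OF a] f n by (auto simp: g_def collapse_def)
    ultimately show ?thesis unfolding leading_terms_def by (auto intro!: exI[of _ g])
  qed
  moreover have "lmap C (Opp a, n) w \<in> leading_terms (n + 1) (W (tail Q a))"
    if a: "a \<in> arcs Q" and n: "n \<in> {1..<l}" and w: "w \<in> leading_terms n (W (head Q a))" for a n w
  proof -
    obtain f where f: "f \<in> W (head Q a)" "\<forall>m<n. f m = 0" "w = f n"
      using w by (auto simp: leading_terms_def)
    define g where "g = lmap (collapse l C) (Opp a) f"
    have "g \<in> W (tail Q a)"
      using W a f(1) unfolding subrep_doubled_quiver_iff g_def by blast
    moreover have "g m = 0" if "m < n + 1" for m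
    proof (cases "m \<in> {2..l}")
      case True
      then have "m - 1 < n" "m - 1 \<in> {1..<l}" using that by auto
      then show ?thesis using Y0[OF a, of "m - 1"] f(2) by (simp add: g_def collapse_def)
    next
      case False
      then show ?thesis unfolding g_def collapse_def by auto
    qed
    moreover have "g (n + 1) = lmap C (Opp a, n) w"
      using f n by (auto simp: g_def collapse_def)
    ultimately show ?thesis unfolding leading_terms_def by (auto intro!: exI[of _ g])
  qed
  ultimately show ?thesis unfolding subrep_chain_quiver_iff by simp
qed

section \<open>Comparison of the two stability conditions\<close>

lemma slope_eq_if_dims_eq:
  assumes th: "\<And>i n. i \<in> verts Q \<Longrightarrow> n \<in> {1..l} \<Longrightarrow> \<theta>l (i, n) = \<theta> i"
    and d: "\<And>i. i \<in> verts Q \<Longrightarrow>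
      vector_space.dim s' (U i) = (\<Sum>n=1..l. vector_space.dim s (W (i, n)))"
  shows "slope s (chain_quiver l Q) \<theta>l W = slope s' (doubled_quiver Q) \<theta> U"
proof -
  have "(\<Sum>p\<in>verts Q \<times> {1..l}. \<theta>l p * int (vector_space.dim s (W p))) =
      (\<Sum>i\<in>verts Q. \<Sum>n=1..l. \<theta>l (i, n) * int (vector_space.dim s (W (i, n))))"
    by (simp add: sum.cartesian_product)
  also have "\<dots> = (\<Sum>i\<in>verts Q. \<theta> i * int (vector_space.dim s' (U i)))"
    by (intro sum.cong refl) (simp add: d th sum_distrib_left)
  finally have "(\<Sum>p\<in>verts Q \<times> {1..l}. \<theta>l p * int (vector_space.dim s (W p))) =
      (\<Sum>i\<in>verts Q. \<theta> i * int (vector_space.dim s' (U i)))" .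
  moreover have "(\<Sum>p\<in>verts Q \<times> {1..l}. vector_space.dim s (W p)) =
      (\<Sum>i\<in>verts Q. vector_space.dim s' (U i))"
    by (simp add: d sum.cartesian_product)
  ultimately show ?thesis
    unfolding slope_def chain_quiver_def doubled_quiver_def by simp
qed

text \<open>
  Properness needs more than equal totals: because \<open>W (i, n)\<close> never has larger dimension than the
  space containing it, the totals at \<open>i\<close> agree only if the dimensions agree in every degree.
\<close>
lemma proper_nonzero_subrep_iff_if_dims_eq:
  assumes s: "vector_space s" and Q: "fin_digraph Q" and C: "quiver_chain s l Q C"
    and W: "subrep s (chain_quiver l Q) C W"
    and U: "subrep (pointwise_scale s) (doubled_quiver Q) (collapse l C) U"
    and d: "\<And>i. i \<in> verts Q \<Longrightarrow> vector_space.dim (pointwise_scale s) (U i) =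
      (\<Sum>n=1..l. vector_space.dim s (W (i, n)))"
    and dC: "\<And>i. i \<in> verts Q \<Longrightarrow> vector_space.dim (pointwise_scale s) (vsp (collapse l C) i) =
      (\<Sum>n=1..l. vector_space.dim s (vsp C (i, n)))"
  shows "proper_nonzero_subrep s (chain_quiver l Q) C W \<longleftrightarrow>
    proper_nonzero_subrep (pointwise_scale s) (doubled_quiver Q) (collapse l C) U"
proof -
  interpret vector_space s by fact
  have R: "quiver_rep s (chain_quiver l Q) C" using C by (simp add: quiver_chain_def)
  have R': "quiver_rep (pointwise_scale s) (doubled_quiver Q) (collapse l C)"
    using nakajima_rep_collapse[OF s Q C] by (simp add: nakajima_rep_def)
  have le: "dim (W (i, n)) \<le> dim (vsp C (i, n))" if i: "i \<in> verts Q" "n \<in> {1..l}" for i n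
  proof -
    have "\<exists>T. finite T \<and> span T = vsp C (i, n)"
      using R i by (auto simp: quiver_rep_def chain_quiver_def)
    then obtain T where "finite T" "span T = vsp C (i, n)" by blast
    moreover have "W (i, n) \<subseteq> vsp C (i, n)" using W i unfolding subrep_chain_quiver_iff by blast
    ultimately show ?thesis using dim_subspace_mono_on[of "W (i, n)" "vsp C (i, n)" T] by simp
  qed
  have full: "(\<Sum>n=1..l. dim (W (i, n))) = (\<Sum>n=1..l. dim (vsp C (i, n))) \<longleftrightarrow>
      (\<forall>n\<in>{1..l}. dim (W (i, n)) = dim (vsp C (i, n)))" if i: "i \<in> verts Q" for i
  proof
    assume eq: "(\<Sum>n=1..l. dim (W (i, n))) = (\<Sum>n=1..l. dim (vsp C (i, n)))"
    show "\<forall>n\<in>{1..l}. dim (W (i, n)) = dim (vsp C (i, n))"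
      using sum_mono_inv[OF eq] le[OF i] by blast
  qed simp
  show ?thesis
    unfolding proper_nonzero_subrep_iff_dim[OF s R]
      proper_nonzero_subrep_iff_dim[OF vector_space_pointwise_scale[OF s] R']
    using W U full by (simp add: chain_quiver_def doubled_quiver_def d dC split_paired_Bex_Sigma)
qed

theorem proposition3p13:
  fixes s :: "'k::field \<Rightarrow> 'v::ab_group_add \<Rightarrow> 'v"
    and Q :: "('i, 'a) pre_digraph"
    and d :: "'i \<Rightarrow> nat"
    and \<theta> :: "'i \<Rightarrow> int"
    and l :: nat
    and dl :: "'i \<times> nat \<Rightarrow> nat"
    and \<theta>l :: "'i \<times> nat \<Rightarrow> int"
    and C :: "('i \<times> nat, 'a arrow \<times> nat, 'v) rep"
  assumes "vector_space s"
    and "fin_digraph Q"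
    and "acyclic_quiver Q"
    and "generic Q d \<theta>"
    and "l \<ge> 1"
    and "\<And>i. i \<in> verts Q \<Longrightarrow> (\<Sum>n=1..l. dl (i, n)) = d i"
    and "\<And>i n. i \<in> verts Q \<Longrightarrow> n \<in> {1..l} \<Longrightarrow> \<theta>l (i, n) = \<theta> i"
    and "quiver_chain s l Q C"
    and "has_dim_vector s (chain_quiver l Q) C dl"
  shows "(semistable s (chain_quiver l Q) \<theta>l C \<longleftrightarrow>
            semistable (pointwise_scale s) (doubled_quiver Q) \<theta> (collapse l C)) \<and>
         (stable s (chain_quiver l Q) \<theta>l C \<longleftrightarrow>
            stable (pointwise_scale s) (doubled_quiver Q) \<theta> (collapse l C))"
proof -
  let ?G = "chain_quiver l Q" and ?H = "doubled_quiver Q"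
  let ?s = "pointwise_scale s" and ?V = "collapse l C"
  note s = assms(1) and th = assms(7) and C = assms(8)
  interpret vector_space s by fact
  interpret P: vector_space ?s using s by (rule vector_space_pointwise_scale)
  interpret Q: fin_digraph Q by fact
  have Q: "wf_digraph Q" by unfold_locales
  have R: "quiver_rep s ?G C" using C by (simp add: quiver_chain_def)
  have sp: "subspace (vsp C (i, n)) \<and> (\<exists>B. finite B \<and> span B = vsp C (i, n))"
    if "i \<in> verts Q" "n \<in> {1..l}" for i n
    using R that by (auto simp: quiver_rep_def chain_quiver_def)
  have dC: "P.dim (vsp ?V i) = (\<Sum>n=1..l. dim (vsp C (i, n)))" if "i \<in> verts Q" for i
    using sp[OF that] by (intro dim_collapse(2)[OF s, where C = C]) auto
  have slope_V: "slope s ?G \<theta>l (vsp C) = slope ?s ?H \<theta> (vsp ?V)"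
    by (rule slope_eq_if_dims_eq) (fact th dC)+
  have up: "\<exists>U. proper_nonzero_subrep ?s ?H ?V U \<and> slope ?s ?H \<theta> U = slope s ?G \<theta>l W"
    if W: "proper_nonzero_subrep s ?G C W" for W
  proof -
    define U where "U = vsp (collapse l (C\<lparr>vsp := W\<rparr>))"
    have sW: "subrep s ?G C W" using W by (simp add: proper_nonzero_subrep_def)
    have sU: "subrep ?s ?H ?V U" unfolding U_def using s Q R sW by (rule subrep_collapse)
    have d: "P.dim (U i) = (\<Sum>n=1..l. dim (W (i, n)))" if "i \<in> verts Q" for i
    proof -
      have "subspace (W (i, n)) \<and> W (i, n) \<subseteq> vsp C (i, n)" if "n \<in> {1..l}" for n
        using sW that \<open>i \<in> verts Q\<close> unfolding subrep_chain_quiver_iff by blast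
      then show ?thesis
        using dim_collapse(2)[OF s, of l "C\<lparr>vsp := W\<rparr>" i C] sp[OF that] by (simp add: U_def)
    qed
    have "slope s ?G \<theta>l W = slope ?s ?H \<theta> U"
      by (rule slope_eq_if_dims_eq) (fact th d)+
    then show ?thesis
      using proper_nonzero_subrep_iff_if_dims_eq[OF s assms(2) C sW sU d dC] W by auto
  qed
  have down: "\<exists>W. proper_nonzero_subrep s ?G C W \<and> slope s ?G \<theta>l W = slope ?s ?H \<theta> U"
    if U: "proper_nonzero_subrep ?s ?H ?V U" for U
  proof -
    define W where "W = (\<lambda>(i, n). leading_terms n (U i))"
    have sU: "subrep ?s ?H ?V U" using U by (simp add: proper_nonzero_subrep_def)
    have sW: "subrep s ?G C W" unfolding W_def using s Q R sU by (rule subrep_leading_terms)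
    have d: "P.dim (U i) = (\<Sum>n=1..l. dim (W (i, n)))" if i: "i \<in> verts Q" for i
    proof -
      have Ui: "P.subspace (U i)" "U i \<subseteq> vsp ?V i"
        using sU i unfolding subrep_doubled_quiver_iff by blast+
      obtain T where T: "finite T" "P.span T = vsp ?V i"
        using finite_span_collapse[OF s sp[OF i]] by blast
      have "f n = 0" if "f \<in> U i" "n \<notin> {1..l}" for f n
        using Ui(2) that by (auto simp: collapse_def)
      then show ?thesis
        using dim_eq_sum_leading_terms[OF s Ui(1) T(1), of l] Ui(2) T(2) by (simp add: W_def)
    qed
    have "slope s ?G \<theta>l W = slope ?s ?H \<theta> U"
      by (rule slope_eq_if_dims_eq) (fact th d)+
    then show ?thesis
      using proper_nonzero_subrep_iff_if_dims_eq[OF s assms(2) C sW sU d dC] U by auto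
  qed
  show ?thesis
    unfolding semistable_def stable_def slope_V using up down by metis
qed

end
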